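(* Let $R,C,T,k,V_{\mathrm{meas}}>0$, $\tau=RC$, $\sigma=2kTR/V_{\mathrm{meas}}$, $T_{\min}=\frac{2T}{\sqrt{1+\sigma}+1}$ and $0<G<\infty$. Consider the steady-state Kalman-Bucy filter with linear feedback, $$\tau\frac{d}{dt}\hat v=-\hat v+R\,i+\frac{\sigma T_{\min}}{2T}\big(v_{\mathrm{meas}}-\hat v\big),\qquad i=-G\hat v .$$ Put $$Z_{\min}=\frac{R}{\sqrt{1+\sigma}-1},\qquad L=\frac{CZ_{\min}}{G},\qquad Z=\frac1G\Big(1+\frac{Z_{\min}}{R}\Big)+Z_{\min}.$$ Then the feedback controller is exactly implemented by an inductance $L$ in series with a resistance $Z$ driven by the measured voltage: the current $i=-G\hat v$ satisfies $$L\frac{di}{dt}=-Z\,i-v_{\mathrm{meas}},$$ and conversely, if $i$ satisfies this equation then $\hat v=-i/G$ satisfies the filter equation above. Moreover, the demon temperature $T_{\mathrm{dem}}:=\frac{V_{\mathrm{meas}}}{2kZ}$ is $$T_{\mathrm{dem}}=\frac{T_{\min}}{2}\,\frac{GR}{GR+\sqrt{1+\sigma}}<T;$$ it increases with $G$, and $$\lim_{G\to\infty}T_{\mathrm{dem}}=\frac12T_{\min}=\frac{T}{\sqrt{1+\sigma}+1}.$$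
   Context: The controller acts on the circuit $\tau\dot v=-v+Ri+\sqrt{2kTR}\,w$ through the current $i$ injected into the capacitor and reads $v_{\mathrm{meas}}=v+\sqrt{V_{\mathrm{meas}}}\,w_{\mathrm{meas}}$, with $w,w_{\mathrm{meas}}$ independent Gaussian white noises. The differential equations driven by $v_{\mathrm{meas}}$ are linear with constant coefficients and are understood as Itô equations with $v_{\mathrm{meas}}\,dt$ replaced by $v\,dt+\sqrt{V_{\mathrm{meas}}}\,dB_{\mathrm{meas}}$, $B_{\mathrm{meas}}$ a standard Brownian motion. The definition of $T_{\mathrm{dem}}$ is the temperature at which the Johnson-Nyquist noise of the resistance $Z$ (of intensity $2kT_{\mathrm{dem}}Z$) equals the measurement noise intensity $V_{\mathrm{meas}}$. *)

theory Defs
  imports "HOL-Probability.Probability"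
begin

text \<open>
  Continuous-time processes are functions of a real time and an outcome; only times
  \<open>t \<ge> 0\<close> matter.
\<close>

definition filtered_space :: "'a measure \<Rightarrow> (real \<Rightarrow> 'a measure) \<Rightarrow> bool" where
  "filtered_space M F \<longleftrightarrow> prob_space M \<and> (\<forall>t\<ge>0. subalgebra M (F t)) \<and>
     (\<forall>s t. 0 \<le> s \<longrightarrow> s \<le> t \<longrightarrow> subalgebra (F t) (F s))"

definition adapted_process :: "(real \<Rightarrow> 'a measure) \<Rightarrow> (real \<Rightarrow> 'a \<Rightarrow> real) \<Rightarrow> bool" where
  "adapted_process F X \<longleftrightarrow> (\<forall>t\<ge>0. X t \<in> borel_measurable (F t))"

definition continuous_paths :: "'a measure \<Rightarrow> (real \<Rightarrow> 'a \<Rightarrow> real) \<Rightarrow> bool" where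
  "continuous_paths M X \<longleftrightarrow> (AE \<omega> in M. continuous_on {0..} (\<lambda>t. X t \<omega>))"

definition brownian_motion ::
  "'a measure \<Rightarrow> (real \<Rightarrow> 'a measure) \<Rightarrow> (real \<Rightarrow> 'a \<Rightarrow> real) \<Rightarrow> bool" where
  "brownian_motion M F W \<longleftrightarrow>
     adapted_process F W \<and> continuous_paths M W \<and> (AE \<omega> in M. W 0 \<omega> = 0) \<and>
     (\<forall>s t. 0 \<le> s \<longrightarrow> s < t \<longrightarrow>
        distributed M lborel (\<lambda>\<omega>. W t \<omega> - W s \<omega>) (normal_density 0 (sqrt (t - s))) \<and>
        prob_space.indep_set M (sets (F s))
          (sets (vimage_algebra (space M) (\<lambda>\<omega>. W t \<omega> - W s \<omega>) borel)))"

text \<open>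
  Two Brownian motions for the same filtration that are independent as processes form a
  two-dimensional Brownian motion for it.
\<close>

definition indep_processes ::
  "'a measure \<Rightarrow> (real \<Rightarrow> 'a \<Rightarrow> real) \<Rightarrow> (real \<Rightarrow> 'a \<Rightarrow> real) \<Rightarrow> bool" where
  "indep_processes M X Y \<longleftrightarrow>
     prob_space.indep_var M
       (Pi\<^sub>M {0..} (\<lambda>_. borel)) (\<lambda>\<omega>. \<lambda>t\<in>{0..}. X t \<omega>)
       (Pi\<^sub>M {0..} (\<lambda>_. borel)) (\<lambda>\<omega>. \<lambda>t\<in>{0..}. Y t \<omega>)"

text \<open>
  The Ito equation \<open>c dX = a dt + b dW\<close> with constants \<open>c\<close>, \<open>b\<close> and a drift process \<open>a\<close>,
  in integrated form. The Ito integral of the constant (hence elementary) integrand \<open>b\<close>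
  over \<open>[0, t]\<close> is by definition \<open>b (W t - W 0)\<close>, so no general stochastic integral is needed.
\<close>

definition ito_equation ::
  "'a measure \<Rightarrow> (real \<Rightarrow> 'a measure) \<Rightarrow> (real \<Rightarrow> 'a \<Rightarrow> real) \<Rightarrow>
   real \<Rightarrow> (real \<Rightarrow> 'a \<Rightarrow> real) \<Rightarrow> (real \<Rightarrow> 'a \<Rightarrow> real) \<Rightarrow> real \<Rightarrow> bool" where
  "ito_equation M F W c X a b \<longleftrightarrow>
     adapted_process F X \<and> continuous_paths M X \<and>
     (AE \<omega> in M. \<forall>t\<ge>0.
        (\<lambda>s. a s \<omega>) absolutely_integrable_on {0..t} \<and>
        c * (X t \<omega> - X 0 \<omega>) =
          integral {0..t} (\<lambda>s. a s \<omega>) + b * (W t \<omega> - W 0 \<omega>))"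

text \<open>
  The equation \<open>c dX/dt = a + g v_meas\<close> with constant gain \<open>g\<close>, where
  \<open>v_meas = v + sqrt V w_meas\<close>: read as an Ito equation by replacing \<open>v_meas dt\<close> with
  \<open>v dt + sqrt V dB\<close>. The argument \<open>a\<close> is the part of the right-hand side free of \<open>v_meas\<close>.
\<close>

definition measurement_driven ::
  "'a measure \<Rightarrow> (real \<Rightarrow> 'a measure) \<Rightarrow> (real \<Rightarrow> 'a \<Rightarrow> real) \<Rightarrow> real \<Rightarrow> (real \<Rightarrow> 'a \<Rightarrow> real) \<Rightarrow>
   real \<Rightarrow> (real \<Rightarrow> 'a \<Rightarrow> real) \<Rightarrow> (real \<Rightarrow> 'a \<Rightarrow> real) \<Rightarrow> real \<Rightarrow> bool" where
  "measurement_driven M F B V v c X a g \<longleftrightarrow>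
     ito_equation M F B c X (\<lambda>t \<omega>. a t \<omega> + g * v t \<omega>) (g * sqrt V)"

definition circuit_equation ::
  "'a measure \<Rightarrow> (real \<Rightarrow> 'a measure) \<Rightarrow> (real \<Rightarrow> 'a \<Rightarrow> real) \<Rightarrow>
   real \<Rightarrow> real \<Rightarrow> real \<Rightarrow> real \<Rightarrow> (real \<Rightarrow> 'a \<Rightarrow> real) \<Rightarrow> (real \<Rightarrow> 'a \<Rightarrow> real) \<Rightarrow> bool" where
  "circuit_equation M F B \<tau> R k T i v \<longleftrightarrow>
     ito_equation M F B \<tau> v (\<lambda>t \<omega>. - v t \<omega> + R * i t \<omega>) (sqrt (2 * k * T * R))"

text \<open>
  The filter \<open>\<tau> d vhat/dt = - vhat + R i + K (v_meas - vhat)\<close> with constant gain \<open>K\<close>,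
  where the term \<open>- K vhat\<close> of the innovation belongs to the \<open>v_meas\<close>-free part.
\<close>

definition filter_equation ::
  "'a measure \<Rightarrow> (real \<Rightarrow> 'a measure) \<Rightarrow> (real \<Rightarrow> 'a \<Rightarrow> real) \<Rightarrow> real \<Rightarrow> (real \<Rightarrow> 'a \<Rightarrow> real) \<Rightarrow>
   real \<Rightarrow> real \<Rightarrow> real \<Rightarrow> (real \<Rightarrow> 'a \<Rightarrow> real) \<Rightarrow> (real \<Rightarrow> 'a \<Rightarrow> real) \<Rightarrow> bool" where
  "filter_equation M F B V v \<tau> R K i vhat \<longleftrightarrow>
     measurement_driven M F B V v \<tau> vhat
       (\<lambda>t \<omega>. - vhat t \<omega> + R * i t \<omega> - K * vhat t \<omega>) K"

definition series_LR_equation ::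
  "'a measure \<Rightarrow> (real \<Rightarrow> 'a measure) \<Rightarrow> (real \<Rightarrow> 'a \<Rightarrow> real) \<Rightarrow> real \<Rightarrow> (real \<Rightarrow> 'a \<Rightarrow> real) \<Rightarrow>
   real \<Rightarrow> real \<Rightarrow> (real \<Rightarrow> 'a \<Rightarrow> real) \<Rightarrow> bool" where
  "series_LR_equation M F B V v L Z i \<longleftrightarrow>
     measurement_driven M F B V v L i (\<lambda>t \<omega>. - Z * i t \<omega>) (- 1)"

definition johnson_nyquist_intensity :: "real \<Rightarrow> real \<Rightarrow> real \<Rightarrow> real" where
  "johnson_nyquist_intensity k T Z = 2 * k * T * Z"

definition demon_temperature :: "real \<Rightarrow> real \<Rightarrow> real \<Rightarrow> real" where
  "demon_temperature k V Z = V / (2 * k * Z)"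

lemma demon_temperature_unique:
  assumes "k > 0" "Z > 0"
  shows "johnson_nyquist_intensity k \<Theta> Z = V \<longleftrightarrow> \<Theta> = demon_temperature k V Z"
  using assms by (auto simp: johnson_nyquist_intensity_def demon_temperature_def field_simps)

end

theory Submission
  imports Defs "HOL-Real_Asymp.Real_Asymp"
begin

text \<open>
  With \<open>s = sqrt (1 + \<sigma>)\<close> the Kalman gain is \<open>s - 1 = R / Zmin\<close>. Substituting
  \<open>i = - G vhat\<close> closes the filter into \<open>\<tau> dvhat/dt = - (s + G R) vhat + (s - 1) v_meas\<close>,
  and dividing by \<open>- (s - 1)\<close> gives the series circuit, so the equivalence is a rescaling of
  an Ito equation by constants. In the same variables \<open>G Z = (s + G R) / (s - 1)\<close>, from
  which the claims about the demon temperature follow.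
\<close>

text \<open>Multiplying the integrated equation by \<open>q\<close> scales drift and noise
  coefficient; \<open>c' * r = q * c\<close> splits the factor on the left between the new
  coefficient and the rescaled process. This works path by path on one set of full measure. The new
  data enter through equations, so that applying the rule to concrete processes leaves only
  algebraic goals.\<close>

lemma ito_equation_rescale:
  assumes X: "ito_equation M F W c X a b"
    and X': "X' = (\<lambda>t \<omega>. r * X t \<omega>)"
    and a': "a' = (\<lambda>t \<omega>. q * a t \<omega>)"
    and b': "b' = q * b"
    and c': "c' * r = q * c"
  shows "ito_equation M F W c' X' a' b'"
  unfolding ito_equation_def
proof (intro conjI)
  show "adapted_process F X'"
    using X unfolding ito_equation_def adapted_process_def X' by auto
  show "continuous_paths M X'"
    using X unfolding ito_equation_def continuous_paths_def X'
    by (auto elim!: eventually_mono intro!: continuous_intros)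
  have "AE \<omega> in M. \<forall>t\<ge>0.
        (\<lambda>s. a s \<omega>) absolutely_integrable_on {0..t} \<and>
        c * (X t \<omega> - X 0 \<omega>) = integral {0..t} (\<lambda>s. a s \<omega>) + b * (W t \<omega> - W 0 \<omega>)"
    using X unfolding ito_equation_def by blast
  then show "AE \<omega> in M. \<forall>t\<ge>0.
        (\<lambda>s. a' s \<omega>) absolutely_integrable_on {0..t} \<and>
        c' * (X' t \<omega> - X' 0 \<omega>) = integral {0..t} (\<lambda>s. a' s \<omega>) + b' * (W t \<omega> - W 0 \<omega>)"
  proof (rule eventually_mono, intro allI impI)
    fix \<omega> and t :: real
    assume *: "\<forall>t\<ge>0. (\<lambda>s. a s \<omega>) absolutely_integrable_on {0..t} \<and>
        c * (X t \<omega> - X 0 \<omega>) = integral {0..t} (\<lambda>s. a s \<omega>) + b * (W t \<omega> - W 0 \<omega>)"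
      and t: "0 \<le> t"
    have "c' * (X' t \<omega> - X' 0 \<omega>) = (c' * r) * (X t \<omega> - X 0 \<omega>)"
      by (simp add: X' algebra_simps)
    also have "\<dots> = q * (c * (X t \<omega> - X 0 \<omega>))"
      by (simp add: c')
    also have "\<dots> = q * integral {0..t} (\<lambda>s. a s \<omega>) + b' * (W t \<omega> - W 0 \<omega>)"
      using * t by (simp add: b' distrib_left)
    finally have "c' * (X' t \<omega> - X' 0 \<omega>) =
        integral {0..t} (\<lambda>s. a' s \<omega>) + b' * (W t \<omega> - W 0 \<omega>)"
      by (simp add: a')
    moreover have "(\<lambda>s. a' s \<omega>) absolutely_integrable_on {0..t}"
      unfolding a' using * t by (intro set_integrable_mult_right) auto
    ultimately show "(\<lambda>s. a' s \<omega>) absolutely_integrable_on {0..t} \<and>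
        c' * (X' t \<omega> - X' 0 \<omega>) = integral {0..t} (\<lambda>s. a' s \<omega>) + b' * (W t \<omega> - W 0 \<omega>)"
      by blast
  qed
qed

text \<open>The factor \<open>r = - G\<close> turns \<open>vhat\<close> into the current, and
  \<open>q = - 1 / K\<close> turns the coefficient \<open>K\<close> of \<open>v\<close> into
  \<open>- 1\<close>. Then \<open>L\<close> is forced by \<open>c' * r = q * c\<close>, and
  \<open>Z\<close> by comparing the drift coefficients of \<open>vhat\<close>.\<close>

lemma filter_imp_series_LR:
  assumes filter: "filter_equation M F B V v \<tau> R K (\<lambda>t \<omega>. - G * vhat t \<omega>) vhat"
    and "G \<noteq> 0" "K \<noteq> 0"
    and L: "L = \<tau> / (K * G)"
    and Z: "Z = (1 + K + G * R) / (K * G)"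
  shows "series_LR_equation M F B V v L Z (\<lambda>t \<omega>. - G * vhat t \<omega>)"
  unfolding series_LR_equation_def measurement_driven_def
  by (rule ito_equation_rescale[where r = "- G" and q = "- 1 / K",
        OF filter[unfolded filter_equation_def measurement_driven_def]])
    (use assms(2,3) in \<open>auto simp: L Z field_simps fun_eq_iff\<close>)

text \<open>The factors are the reciprocals of those in \<open>filter_imp_series_LR\<close>, so the
  same values of \<open>L\<close> and \<open>Z\<close> make the coefficients match.\<close>

lemma series_LR_imp_filter:
  assumes LR: "series_LR_equation M F B V v L Z i"
    and "G \<noteq> 0" "K \<noteq> 0"
    and L: "L = \<tau> / (K * G)"
    and Z: "Z = (1 + K + G * R) / (K * G)"
  shows "filter_equation M F B V v \<tau> R K i (\<lambda>t \<omega>. - i t \<omega> / G)"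
  unfolding filter_equation_def measurement_driven_def
  by (rule ito_equation_rescale[where r = "- 1 / G" and q = "- K",
        OF LR[unfolded series_LR_equation_def measurement_driven_def]])
    (use assms(2,3) in \<open>auto simp: L Z field_simps fun_eq_iff\<close>)

theorem mainTheorem6:
  fixes R C T k Vmeas \<tau> \<sigma> Tmin Zmin G :: real
    and L Z Tdem :: "real \<Rightarrow> real"
    and M :: "'a measure" and F :: "real \<Rightarrow> 'a measure"
    and B Bmeas :: "real \<Rightarrow> 'a \<Rightarrow> real"
  assumes pos: "R > 0" "C > 0" "T > 0" "k > 0" "Vmeas > 0"
    and tau: "\<tau> = R * C"
    and sigma: "\<sigma> = 2 * k * T * R / Vmeas"
    and Tmin: "Tmin = 2 * T / (sqrt (1 + \<sigma>) + 1)"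
    and Zmin: "Zmin = R / (sqrt (1 + \<sigma>) - 1)"
    and L: "L = (\<lambda>g. C * Zmin / g)"
    and Z: "Z = (\<lambda>g. 1 / g * (1 + Zmin / R) + Zmin)"
    and Tdem: "Tdem = (\<lambda>g. demon_temperature k Vmeas (Z g))"
    and G: "G > 0"
    and noise: "filtered_space M F" "brownian_motion M F B" "brownian_motion M F Bmeas"
      "indep_processes M B Bmeas"
  shows
    "(\<forall>v vhat i. i = (\<lambda>t \<omega>. - G * vhat t \<omega>) \<longrightarrow>
        circuit_equation M F B \<tau> R k T i v \<longrightarrow>
        filter_equation M F Bmeas Vmeas v \<tau> R (\<sigma> * Tmin / (2 * T)) i vhat \<longrightarrow>
        series_LR_equation M F Bmeas Vmeas v (L G) (Z G) i)
   \<and> (\<forall>v i vhat. vhat = (\<lambda>t \<omega>. - i t \<omega> / G) \<longrightarrow>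
        circuit_equation M F B \<tau> R k T i v \<longrightarrow>
        series_LR_equation M F Bmeas Vmeas v (L G) (Z G) i \<longrightarrow>
        i = (\<lambda>t \<omega>. - G * vhat t \<omega>) \<and>
        filter_equation M F Bmeas Vmeas v \<tau> R (\<sigma> * Tmin / (2 * T)) i vhat)
   \<and> Tdem G = Tmin / 2 * (G * R / (G * R + sqrt (1 + \<sigma>)))
   \<and> Tdem G < T
   \<and> strict_mono_on {0<..} Tdem
   \<and> (Tdem \<longlongrightarrow> 1 / 2 * Tmin) at_top
   \<and> 1 / 2 * Tmin = T / (sqrt (1 + \<sigma>) + 1)"
proof -
  define s where "s = sqrt (1 + \<sigma>)"
  have "\<sigma> > 0"
    using pos by (simp add: sigma)
  then have s: "s > 1" and \<sigma>: "\<sigma> = (s - 1) * (s + 1)"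
    by (simp_all add: s_def algebra_simps)
  have Tmin_s: "Tmin = 2 * T / (s + 1)"
    by (simp add: Tmin s_def)
  \<comment> \<open>Expanding \<open>Tmin\<close> first leaves \<sigma> / (s + 1); only then is
    \<sigma> factored, so that \<open>s + 1\<close> cancels.\<close>
  have gain: "\<sigma> * Tmin / (2 * T) = s - 1"
    using pos s by (simp add: Tmin_s) (simp add: \<sigma>)
  have Zmin_s: "Zmin = R / (s - 1)"
    by (simp add: Zmin s_def)
  have L_g: "L g = \<tau> / ((s - 1) * g)" for g
    by (simp add: L Zmin_s tau)
  \<comment> \<open>The numerator keeps \<open>1 + (s - 1)\<close> unsimplified to fit the
    hypothesis on \<open>Z\<close> in the two circuit lemmas with \<open>K = s - 1\<close>.\<close>
  have Z_g: "Z g = (1 + (s - 1) + g * R) / ((s - 1) * g)" if "g > 0" for g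
  proof -
    \<comment> \<open>Writing \<open>s = 1 + K\<close> makes every denominator a product of positive
      variables.\<close>
    obtain K where "s = 1 + K" "K > 0"
      using s that[of "s - 1"] by simp
    then show ?thesis
      using that pos by (simp add: Z Zmin_s field_simps)
  qed
  \<comment> \<open>Eliminating \<open>Vmeas\<close> makes \<open>k\<close> and the factor
    \<open>s - 1\<close> cancel in the demon temperature.\<close>
  have V: "Vmeas = 2 * k * T * R / ((s - 1) * (s + 1))"
    using pos by (simp add: sigma flip: \<sigma>)
  have Tdem_g: "Tdem g = T / (s + 1) * (g * R / (g * R + s))" if "g > 0" for g
  proof -
    have "g * R + s > 0"
      using that pos s by (simp add: add_pos_pos)
    then show ?thesis
      using that pos s
      by (simp add: Tdem demon_temperature_def Z_g V divide_simps)
  qed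
  have half_Tmin: "Tmin / 2 = T / (s + 1)"
    using s by (simp add: Tmin_s divide_simps)
  have "Tdem G < T"
  proof -
    \<comment> \<open>Both factors of the closed form lose something: the fraction is below 1, and
      \<open>T / (s + 1)\<close> is already below \<open>T\<close>.\<close>
    have "G * R / (G * R + s) < 1"
      using G pos s by (simp add: add_pos_pos)
    moreover have "T / (s + 1) < T" and "T / (s + 1) > 0"
      using pos s by (simp_all add: field_simps)
    ultimately have "T / (s + 1) * (G * R / (G * R + s)) < T"
      by (smt (verit) mult_left_le)
    then show ?thesis
      by (simp add: Tdem_g G)
  qed
  moreover have "strict_mono_on {0<..} Tdem"
  proof (rule strict_mono_onI)
    fix x y :: real
    assume xy: "x \<in> {0<..}" "y \<in> {0<..}" "x < y"
    then have "x * R + s > 0" "y * R + s > 0"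
      using pos s by (simp_all add: add_pos_pos)
    \<comment> \<open>After cross-multiplication the terms in \<open>x * y\<close> cancel, leaving
      \<open>x * R * s < y * R * s\<close>.\<close>
    then have "x * R / (x * R + s) < y * R / (y * R + s)"
      using xy pos s by (simp add: divide_simps algebra_simps)
    moreover have "T / (s + 1) > 0"
      using pos s by simp
    ultimately show "Tdem x < Tdem y"
      using xy by (simp only: Tdem_g greaterThan_iff mult_strict_left_mono)
  qed
  moreover have "(Tdem \<longlongrightarrow> 1 / 2 * Tmin) at_top"
  proof -
    have "((\<lambda>g. T / (s + 1) * (g * R / (g * R + s))) \<longlongrightarrow> T / (s + 1)) at_top"
      using pos s by real_asymp
    \<comment> \<open>The closed form of \<open>Tdem\<close> is available only for positive
      arguments, which suffices because the limit is taken along \<open>at_top\<close>.\<close>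
    then show ?thesis
      using half_Tmin
      by (subst filterlim_cong[OF refl refl, where g = "\<lambda>g. T / (s + 1) * (g * R / (g * R + s))"])
        (auto intro: eventually_mono[OF eventually_gt_at_top[of 0]] simp: Tdem_g)
  qed
  moreover have "Tdem G = Tmin / 2 * (G * R / (G * R + sqrt (1 + \<sigma>)))"
    by (simp only: Tdem_g[OF G] half_Tmin flip: s_def)
  moreover have "1 / 2 * Tmin = T / (sqrt (1 + \<sigma>) + 1)"
    using half_Tmin by (simp flip: s_def)
  moreover have "series_LR_equation M F Bmeas Vmeas v (L G) (Z G) (\<lambda>t \<omega>. - G * vhat t \<omega>)"
    if "filter_equation M F Bmeas Vmeas v \<tau> R (\<sigma> * Tmin / (2 * T)) (\<lambda>t \<omega>. - G * vhat t \<omega>) vhat"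
    for v vhat
    using that G s unfolding gain by (intro filter_imp_series_LR[OF _ _ _ L_g Z_g]) auto
  moreover have "filter_equation M F Bmeas Vmeas v \<tau> R (\<sigma> * Tmin / (2 * T)) i (\<lambda>t \<omega>. - i t \<omega> / G)"
    if "series_LR_equation M F Bmeas Vmeas v (L G) (Z G) i" for v i
    using that G s unfolding gain by (intro series_LR_imp_filter[OF _ _ _ L_g Z_g]) auto
  moreover have "i = (\<lambda>t \<omega>. - G * (- i t \<omega> / G))" for i :: "real \<Rightarrow> 'a \<Rightarrow> real"
    using G by simp
  ultimately show ?thesis
    by blast
qed

end
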